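(* Let $A$ and $B$ be metagroups, let $Z$ be a commutative group, and let $\Xi,\phi,\eta,\kappa,\xi$ be data satisfying the smashing conditions listed in the context. Then the Cartesian product $A\times B$ supplied with the binary operation $$(a_1,b_1)\star(a_2,b_2)=\bigl(a_1a_2,\ \xi((a_1,b_1),(a_2,b_2))\,b_2^{a_1}b_1\bigr),\qquad a_1,a_2\in A,\ b_1,b_2\in B,$$ is a metagroup, denoted $C_2=A\star^{\phi,\eta,\kappa,\xi}B$. Moreover, there exist embeddings of $A$ and $B$ into $C_2$ such that $B$ is an almost normal submetagroup in $C_2$. If additionally $Z_m(C_2)\subseteq Z_m(B)\subseteq Z$, then $B$ is a normal submetagroup in $C_2$.
   Context: Metagroups. A loop is a set $G$ with a single-valued binary operation such that for all $a,b\in G$ there are a unique $x=a\setminus b$ with $ax=b$ and a unique $y=b/a$ with $ya=b$, and there is a neutral element $e$. Its center is $Z(G)=Com(G)\cap N(G)$, where $Com(G)=\{a:\ ab=ba\ \forall b\in G\}$ and $N(G)$ is the set of $a\in G$ with $(ab)c=a(bc)$, $(ba)c=b(ac)$, $(bc)a=b(ca)$ for all $b,c\in G$. A metagroup is a loop $G$ such that $(ab)c=t_G(a,b,c)\,a(bc)$ with $t_G(a,b,c)\in Z(G)$ for all $a,b,c\in G$. $Z_m(G)$ denotes the minimal subgroup of $Z(G)$ containing all $t_G(a,b,c)$, $a,b,c\in G$. A submetagroup is a subset that is a metagroup under the restricted operation. A submetagroup $H$ of $G$ is almost normal if $gH=Hg$ for each $g\in G$; it is normal if in addition $(gH)k=g(Hk)$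 and $k(gH)=(kg)H$ for all $g,k\in G$. Smashing conditions. (1) $Z$ is a commutative group with embeddings $Z_m(A)\hookrightarrow Z$, $Z_m(B)\hookrightarrow Z$, $Z\hookrightarrow Z(A)$, $Z\hookrightarrow Z(B)$; elements of $Z$ are regarded as elements of $A$ and of $B$. (2) On $A\times B$ an equivalence relation $\Xi$ is considered such that $(\gamma v,b)\,\Xi\,(v,\gamma b)$, $(\gamma v,b)\,\Xi\,\gamma(v,b)$ and $(\gamma v,b)\,\Xi\,(v,b)\gamma$ for every $v\in A$, $b\in B$, $\gamma\in Z$ (where $\gamma\in Z$ is identified with $(\gamma,e)$ and with $(e,\gamma)$, so that a factor from $Z$ may be moved between the coordinates). (3) $\phi:A\to\mathcal A(B)$ is a single-valued map into a family of bijections of $B$ onto $B$; one writes $b^a=\phi(a)b$. There are single-valued maps $\eta:A\times A\times B\to Z$, $\kappa:A\times B\times B\to Z$, $\xi:((A\times B)/\Xi)\times((A\times B)/\Xi)\to Z$ ($\xi$ is evaluated on classes of pairs), such that for all $u,v\in A$, $b,c\in B$, $\gamma\in Z$: (4) $(b^u)^v=b^{vu}\eta(v,u,b)$, $e^u=e$, $b^e=b$; (5) $\eta(v,u,\gamma b)=\eta(v,u,b)$; (6) $(cb)^u=c^ub^u\kappa(u,c,b)$; (7) $\kappa(u,\gamma c,b)=\kappa(u,c,\gamma b)=\kappa(u,c,b)$ and $\kappa(u,\gamma,b)=\kappa(u,b,\gamma)=e$; (8) $\xi((\gamma u,c),(v,b))=\xi((u,c),(\gamma v,b))=\xi((u,c),(v,b))$,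 $\xi((\gamma,e),(v,b))=e$ and $\xi((u,c),(\gamma,e))=e$. Here $e$ denotes the neutral element of $Z$, $A$ and $B$. Under these conditions $\gamma^a=\gamma$ and $b^\gamma=b$ for all $\gamma\in Z$, $a\in A$, $b\in B$. Embeddings: $A$ and $B$ are embedded into $A\times B$ as $\{(a,e): a\in A\}$ and $\{(e,b): b\in B\}$, and inclusions between $Z_m(C_2)$, $Z_m(B)$ and $Z$ are understood via these identifications.
   Formalization: Adds the hypothesis η(γ,u,b)=e for γ in Z_m(A), u in A, b in B: without it A×B with ⋆ can fail to be a metagroup, and it is necessary for the claim. Embeddings are the injective maps a↦(a,e), b↦(e,b), not homomorphisms. *)

theory Defs
  imports "HOL-Algebra.Generated_Groups"
begin

section \<open>Loops and metagroups\<close>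

text \<open>The type of \<open>monoid\<close> records is used only as a carrier type for a binary operation with a
  distinguished element; no associativity is assumed.\<close>

locale loop =
  fixes G (structure)
  assumes m_closed: "\<lbrakk>a \<in> carrier G; b \<in> carrier G\<rbrakk> \<Longrightarrow> a \<otimes> b \<in> carrier G"
    and one_closed: "\<one> \<in> carrier G"
    and l_one: "a \<in> carrier G \<Longrightarrow> \<one> \<otimes> a = a"
    and r_one: "a \<in> carrier G \<Longrightarrow> a \<otimes> \<one> = a"
    and left_division: "\<lbrakk>a \<in> carrier G; b \<in> carrier G\<rbrakk> \<Longrightarrow> \<exists>!x. x \<in> carrier G \<and> a \<otimes> x = b"
    and right_division: "\<lbrakk>a \<in> carrier G; b \<in> carrier G\<rbrakk> \<Longrightarrow> \<exists>!y. y \<in> carrier G \<and> y \<otimes> a = b"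

definition commutant :: "('a, 'm) monoid_scheme \<Rightarrow> 'a set"
  where "commutant G = {a \<in> carrier G. \<forall>b \<in> carrier G. a \<otimes>\<^bsub>G\<^esub> b = b \<otimes>\<^bsub>G\<^esub> a}"

definition nucleus :: "('a, 'm) monoid_scheme \<Rightarrow> 'a set"
  where "nucleus G = {a \<in> carrier G. \<forall>b \<in> carrier G. \<forall>c \<in> carrier G.
      (a \<otimes>\<^bsub>G\<^esub> b) \<otimes>\<^bsub>G\<^esub> c = a \<otimes>\<^bsub>G\<^esub> (b \<otimes>\<^bsub>G\<^esub> c) \<and>
      (b \<otimes>\<^bsub>G\<^esub> a) \<otimes>\<^bsub>G\<^esub> c = b \<otimes>\<^bsub>G\<^esub> (a \<otimes>\<^bsub>G\<^esub> c) \<and>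
      (b \<otimes>\<^bsub>G\<^esub> c) \<otimes>\<^bsub>G\<^esub> a = b \<otimes>\<^bsub>G\<^esub> (c \<otimes>\<^bsub>G\<^esub> a)}"

definition center :: "('a, 'm) monoid_scheme \<Rightarrow> 'a set"
  where "center G = commutant G \<inter> nucleus G"

text \<open>In a loop this element exists and is unique, by right division.\<close>

definition assoc_factor :: "('a, 'm) monoid_scheme \<Rightarrow> 'a \<Rightarrow> 'a \<Rightarrow> 'a \<Rightarrow> 'a"
  where "assoc_factor G a b c =
    (THE t. t \<in> carrier G \<and> (a \<otimes>\<^bsub>G\<^esub> b) \<otimes>\<^bsub>G\<^esub> c = t \<otimes>\<^bsub>G\<^esub> (a \<otimes>\<^bsub>G\<^esub> (b \<otimes>\<^bsub>G\<^esub> c)))"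

locale metagroup = loop +
  assumes assoc_factor_center:
    "\<lbrakk>a \<in> carrier G; b \<in> carrier G; c \<in> carrier G\<rbrakk> \<Longrightarrow> assoc_factor G a b c \<in> center G"

text \<open>The subgroup of the commutative group \<open>center G\<close> generated by all \<open>assoc_factor G a b c\<close>.\<close>

definition min_center :: "('a, 'm) monoid_scheme \<Rightarrow> 'a set"
  where "min_center G = generate (G\<lparr>carrier := center G\<rparr>)
    {assoc_factor G a b c | a b c. a \<in> carrier G \<and> b \<in> carrier G \<and> c \<in> carrier G}"

text \<open>Keeping the neutral element of \<open>G\<close> is no restriction: the neutral element \<open>e'\<close> of a
  subset that is a loop under the operation of \<open>G\<close> satisfies \<open>e' \<otimes> e' = e'\<close>, so it
  is \<open>\<one>\<close> by cancellation.\<close>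

definition submetagroup :: "'a set \<Rightarrow> ('a, 'm) monoid_scheme \<Rightarrow> bool"
  where "submetagroup H G \<longleftrightarrow> H \<subseteq> carrier G \<and> metagroup (G\<lparr>carrier := H\<rparr>)"

definition almost_normal_submetagroup :: "'a set \<Rightarrow> ('a, 'm) monoid_scheme \<Rightarrow> bool"
  where "almost_normal_submetagroup H G \<longleftrightarrow> submetagroup H G \<and>
    (\<forall>g \<in> carrier G. g <#\<^bsub>G\<^esub> H = H #>\<^bsub>G\<^esub> g)"

definition normal_submetagroup :: "'a set \<Rightarrow> ('a, 'm) monoid_scheme \<Rightarrow> bool"
  where "normal_submetagroup H G \<longleftrightarrow> almost_normal_submetagroup H G \<and>
    (\<forall>g \<in> carrier G. \<forall>k \<in> carrier G.
      (g <#\<^bsub>G\<^esub> H) #>\<^bsub>G\<^esub> k = g <#\<^bsub>G\<^esub> (H #>\<^bsub>G\<^esub> k) \<and>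
      k <#\<^bsub>G\<^esub> (g <#\<^bsub>G\<^esub> H) = (k \<otimes>\<^bsub>G\<^esub> g) <#\<^bsub>G\<^esub> H)"

section \<open>Smashing data\<close>

text \<open>The embeddings of \<open>Z\<close> into the centers of \<open>A\<close> and \<open>B\<close> are \<open>\<iota>A\<close> and \<open>\<iota>B\<close>. The embedding of
  \<open>min_center A\<close> into \<open>Z\<close> is compatible with \<open>\<iota>A\<close> and the inclusion of \<open>min_center A\<close> in \<open>A\<close>,
  so it amounts to \<open>min_center A \<subseteq> \<iota>A ` carrier Z\<close>; similarly for \<open>B\<close>.

  The power \<open>b\<^sup>a\<close> is \<open>\<phi> a b\<close>, and \<open>\<xi>\<close> takes \<open>\<Xi>\<close>-classes as arguments.
  In the conditions on \<open>\<Xi>\<close>, the product of an element of \<open>Z\<close> with a pair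
  is the componentwise one, where the element of \<open>Z\<close> is read both as \<open>(\<iota>A \<gamma>, \<one>)\<close> and as
  \<open>(\<one>, \<iota>B \<gamma>)\<close>.\<close>

locale smashing_data =
  A: metagroup A + B: metagroup B + Z: comm_group Z
  for A :: "'a monoid" (structure) and B :: "'b monoid" (structure) and Z :: "'z monoid" (structure) +
  fixes \<iota>A :: "'z \<Rightarrow> 'a" and \<iota>B :: "'z \<Rightarrow> 'b"
    and \<Xi> :: "(('a \<times> 'b) \<times> ('a \<times> 'b)) set"
    and \<phi> :: "'a \<Rightarrow> 'b \<Rightarrow> 'b"
    and \<eta> :: "'a \<Rightarrow> 'a \<Rightarrow> 'b \<Rightarrow> 'z"
    and \<kappa> :: "'a \<Rightarrow> 'b \<Rightarrow> 'b \<Rightarrow> 'z"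
    and \<xi> :: "('a \<times> 'b) set \<Rightarrow> ('a \<times> 'b) set \<Rightarrow> 'z"
  assumes \<iota>A_hom: "\<iota>A \<in> hom Z (A\<lparr>carrier := center A\<rparr>)"
    and \<iota>A_inj: "inj_on \<iota>A (carrier Z)"
    and min_center_A: "min_center A \<subseteq> \<iota>A ` carrier Z"
    and \<iota>B_hom: "\<iota>B \<in> hom Z (B\<lparr>carrier := center B\<rparr>)"
    and \<iota>B_inj: "inj_on \<iota>B (carrier Z)"
    and min_center_B: "min_center B \<subseteq> \<iota>B ` carrier Z"
    and \<Xi>_equiv: "equiv (carrier A \<times> carrier B) \<Xi>"
    and \<Xi>_swap: "\<lbrakk>\<gamma> \<in> carrier Z; v \<in> carrier A; b \<in> carrier B\<rbrakk> \<Longrightarrow>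
      ((\<iota>A \<gamma> \<otimes>\<^bsub>A\<^esub> v, b), (v, \<iota>B \<gamma> \<otimes>\<^bsub>B\<^esub> b)) \<in> \<Xi>"
    and \<Xi>_left: "\<lbrakk>\<gamma> \<in> carrier Z; v \<in> carrier A; b \<in> carrier B;
        \<zeta> \<in> {(\<iota>A \<gamma>, \<one>\<^bsub>B\<^esub>), (\<one>\<^bsub>A\<^esub>, \<iota>B \<gamma>)}\<rbrakk> \<Longrightarrow>
      ((\<iota>A \<gamma> \<otimes>\<^bsub>A\<^esub> v, b), \<zeta> \<otimes>\<^bsub>A \<times>\<times> B\<^esub> (v, b)) \<in> \<Xi>"
    and \<Xi>_right: "\<lbrakk>\<gamma> \<in> carrier Z; v \<in> carrier A; b \<in> carrier B;
        \<zeta> \<in> {(\<iota>A \<gamma>, \<one>\<^bsub>B\<^esub>), (\<one>\<^bsub>A\<^esub>, \<iota>B \<gamma>)}\<rbrakk> \<Longrightarrow>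
      ((\<iota>A \<gamma> \<otimes>\<^bsub>A\<^esub> v, b), (v, b) \<otimes>\<^bsub>A \<times>\<times> B\<^esub> \<zeta>) \<in> \<Xi>"
    and \<phi>_bij: "u \<in> carrier A \<Longrightarrow> bij_betw (\<phi> u) (carrier B) (carrier B)"
    and \<eta>_closed: "\<lbrakk>v \<in> carrier A; u \<in> carrier A; b \<in> carrier B\<rbrakk> \<Longrightarrow> \<eta> v u b \<in> carrier Z"
    and \<kappa>_closed: "\<lbrakk>u \<in> carrier A; c \<in> carrier B; b \<in> carrier B\<rbrakk> \<Longrightarrow> \<kappa> u c b \<in> carrier Z"
    and \<xi>_closed: "\<lbrakk>p \<in> (carrier A \<times> carrier B) // \<Xi>; q \<in> (carrier A \<times> carrier B) // \<Xi>\<rbrakk> \<Longrightarrow>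
      \<xi> p q \<in> carrier Z"
    and \<phi>_\<phi>: "\<lbrakk>u \<in> carrier A; v \<in> carrier A; b \<in> carrier B\<rbrakk> \<Longrightarrow>
      \<phi> v (\<phi> u b) = \<phi> (v \<otimes>\<^bsub>A\<^esub> u) b \<otimes>\<^bsub>B\<^esub> \<iota>B (\<eta> v u b)"
    and \<phi>_one_right: "u \<in> carrier A \<Longrightarrow> \<phi> u \<one>\<^bsub>B\<^esub> = \<one>\<^bsub>B\<^esub>"
    and \<phi>_one_left: "b \<in> carrier B \<Longrightarrow> \<phi> \<one>\<^bsub>A\<^esub> b = b"
    and \<eta>_central: "\<lbrakk>v \<in> carrier A; u \<in> carrier A; b \<in> carrier B; \<gamma> \<in> carrier Z\<rbrakk> \<Longrightarrow>
      \<eta> v u (\<iota>B \<gamma> \<otimes>\<^bsub>B\<^esub> b) = \<eta> v u b"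
    and \<phi>_mult: "\<lbrakk>u \<in> carrier A; c \<in> carrier B; b \<in> carrier B\<rbrakk> \<Longrightarrow>
      \<phi> u (c \<otimes>\<^bsub>B\<^esub> b) = (\<phi> u c \<otimes>\<^bsub>B\<^esub> \<phi> u b) \<otimes>\<^bsub>B\<^esub> \<iota>B (\<kappa> u c b)"
    and \<kappa>_central: "\<lbrakk>u \<in> carrier A; c \<in> carrier B; b \<in> carrier B; \<gamma> \<in> carrier Z\<rbrakk> \<Longrightarrow>
      \<kappa> u (\<iota>B \<gamma> \<otimes>\<^bsub>B\<^esub> c) b = \<kappa> u c b \<and> \<kappa> u c (\<iota>B \<gamma> \<otimes>\<^bsub>B\<^esub> b) = \<kappa> u c b"
    and \<kappa>_one: "\<lbrakk>u \<in> carrier A; b \<in> carrier B; \<gamma> \<in> carrier Z\<rbrakk> \<Longrightarrow>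
      \<kappa> u (\<iota>B \<gamma>) b = \<one>\<^bsub>Z\<^esub> \<and> \<kappa> u b (\<iota>B \<gamma>) = \<one>\<^bsub>Z\<^esub>"
    and \<xi>_central: "\<lbrakk>u \<in> carrier A; c \<in> carrier B; v \<in> carrier A; b \<in> carrier B; \<gamma> \<in> carrier Z\<rbrakk> \<Longrightarrow>
      \<xi> (\<Xi> `` {(\<iota>A \<gamma> \<otimes>\<^bsub>A\<^esub> u, c)}) (\<Xi> `` {(v, b)}) = \<xi> (\<Xi> `` {(u, c)}) (\<Xi> `` {(v, b)}) \<and>
      \<xi> (\<Xi> `` {(u, c)}) (\<Xi> `` {(\<iota>A \<gamma> \<otimes>\<^bsub>A\<^esub> v, b)}) = \<xi> (\<Xi> `` {(u, c)}) (\<Xi> `` {(v, b)})"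
    and \<xi>_one_left: "\<lbrakk>v \<in> carrier A; b \<in> carrier B; \<gamma> \<in> carrier Z\<rbrakk> \<Longrightarrow>
      \<xi> (\<Xi> `` {(\<iota>A \<gamma>, \<one>\<^bsub>B\<^esub>)}) (\<Xi> `` {(v, b)}) = \<one>\<^bsub>Z\<^esub>"
    and \<xi>_one_right: "\<lbrakk>u \<in> carrier A; c \<in> carrier B; \<gamma> \<in> carrier Z\<rbrakk> \<Longrightarrow>
      \<xi> (\<Xi> `` {(u, c)}) (\<Xi> `` {(\<iota>A \<gamma>, \<one>\<^bsub>B\<^esub>)}) = \<one>\<^bsub>Z\<^esub>"
    \<comment> \<open>The next two conditions do not follow from the preceding ones.\<close>
    and \<phi>_fixes_Z: "\<lbrakk>u \<in> carrier A; \<gamma> \<in> carrier Z\<rbrakk> \<Longrightarrow> \<phi> u (\<iota>B \<gamma>) = \<iota>B \<gamma>"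
    and \<phi>_Z_trivial: "\<lbrakk>b \<in> carrier B; \<gamma> \<in> carrier Z\<rbrakk> \<Longrightarrow> \<phi> (\<iota>A \<gamma>) b = b"

section \<open>The smashed product\<close>

text \<open>The smashing conditions do not exclude that multiplying \<open>u\<close> by an element of \<open>min_center A\<close>
  changes \<open>\<phi> u\<close>. The obstruction is \<open>\<eta> (\<iota>A \<gamma>) u b\<close>, since \<open>\<phi> u b = \<phi> (\<iota>A \<gamma> \<otimes> u) b \<otimes> \<iota>B (\<eta> (\<iota>A \<gamma>) u b)\<close>.
  If it is nontrivial for some \<open>\<iota>A \<gamma> \<in> min_center A\<close>, then the smashed product is a loop but
  not a metagroup.\<close>

definition smashed_product ::
  "'a monoid \<Rightarrow> 'b monoid \<Rightarrow> ('z \<Rightarrow> 'b) \<Rightarrow> (('a \<times> 'b) \<times> ('a \<times> 'b)) set \<Rightarrow> ('a \<Rightarrow> 'b \<Rightarrow> 'b) \<Rightarrow>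
    (('a \<times> 'b) set \<Rightarrow> ('a \<times> 'b) set \<Rightarrow> 'z) \<Rightarrow> ('a \<times> 'b) monoid"
  where "smashed_product A B \<iota>B \<Xi> \<phi> \<xi> =
    \<lparr>carrier = carrier A \<times> carrier B,
     mult = (\<lambda>(a1, b1) (a2, b2).
       (a1 \<otimes>\<^bsub>A\<^esub> a2,
        \<iota>B (\<xi> (\<Xi> `` {(a1, b1)}) (\<Xi> `` {(a2, b2)})) \<otimes>\<^bsub>B\<^esub> (\<phi> a1 b2 \<otimes>\<^bsub>B\<^esub> b1))),
     one = (\<one>\<^bsub>A\<^esub>, \<one>\<^bsub>B\<^esub>)\<rparr>"

text \<open>These embeddings are injective maps of sets; in general they are not homomorphisms into
  the smashed product.\<close>

definition embed_left :: "'b monoid \<Rightarrow> 'a \<Rightarrow> 'a \<times> 'b"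
  where "embed_left B a = (a, \<one>\<^bsub>B\<^esub>)"

definition embed_right :: "'a monoid \<Rightarrow> 'b \<Rightarrow> 'a \<times> 'b"
  where "embed_right A b = (\<one>\<^bsub>A\<^esub>, b)"

end

theory Submission
  imports Defs
begin

text \<open>A pair \<open>(\<iota>A \<alpha>, \<iota>B \<beta>)\<close> acts on the smashed product by multiplying the coordinates by
  \<open>\<iota>A \<alpha>\<close> and \<open>\<iota>B \<beta>\<close>, because \<open>\<xi>\<close>, seen on \<open>\<Xi>\<close>-classes, ignores central factors in
  both coordinates. It is central as soon as \<open>\<phi> (\<iota>A \<alpha> \<otimes> u) = \<phi> u\<close> for all \<open>u\<close>, and this is
  what the vanishing of \<open>\<eta> (\<iota>A \<alpha>)\<close> gives. Expanding both bracketings of a triple product shows that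
  they differ by such a pair with \<open>\<iota>A \<alpha>\<close> the associator in \<open>A\<close>. For the divisions, \<open>\<xi>\<close> depends on
  the unknown coordinate only modulo \<open>Z\<close>, so the equation is first solved without \<open>\<xi>\<close> and the
  solution is then corrected by the inverse of \<open>\<xi>\<close>. Finally, the cosets of \<open>B\<close>
  are the fibres of the projection to \<open>A\<close>, and translations permute these fibres.\<close>

section \<open>Loops and their centers\<close>

context loop
begin

lemma l_cancel:
  assumes "a \<in> carrier G" "x \<in> carrier G" "y \<in> carrier G" "a \<otimes> x = a \<otimes> y"
  shows "x = y"
  using left_division[of a "a \<otimes> y"] assms m_closed by metis

lemma r_cancel:
  assumes "a \<in> carrier G" "x \<in> carrier G" "y \<in> carrier G" "x \<otimes> a = y \<otimes> a"
  shows "x = y"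
  using right_division[of a "y \<otimes> a"] assms m_closed by metis

lemma assoc_factor_eqI:
  assumes "a \<in> carrier G" "b \<in> carrier G" "c \<in> carrier G" "t \<in> carrier G"
    and "(a \<otimes> b) \<otimes> c = t \<otimes> (a \<otimes> (b \<otimes> c))"
  shows "assoc_factor G a b c = t"
  unfolding assoc_factor_def
proof (rule the_equality)
  fix s assume "s \<in> carrier G \<and> (a \<otimes> b) \<otimes> c = s \<otimes> (a \<otimes> (b \<otimes> c))"
  then show "s = t"
    using assms r_cancel[of "a \<otimes> (b \<otimes> c)" s t] m_closed by simp
qed (use assms in simp)

lemma assoc_factor_closed_eq:
  assumes "a \<in> carrier G" "b \<in> carrier G" "c \<in> carrier G"
  shows "assoc_factor G a b c \<in> carrier G \<and>
    (a \<otimes> b) \<otimes> c = assoc_factor G a b c \<otimes> (a \<otimes> (b \<otimes> c))"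
proof -
  have "a \<otimes> (b \<otimes> c) \<in> carrier G" "(a \<otimes> b) \<otimes> c \<in> carrier G"
    using assms m_closed by auto
  then obtain t where "t \<in> carrier G" "t \<otimes> (a \<otimes> (b \<otimes> c)) = (a \<otimes> b) \<otimes> c"
    using right_division by blast
  then show ?thesis
    using assoc_factor_eqI assms by metis
qed

lemma center_closed: "z \<in> center G \<Longrightarrow> z \<in> carrier G"
  by (simp add: center_def commutant_def)

lemma center_comm: "\<lbrakk>z \<in> center G; x \<in> carrier G\<rbrakk> \<Longrightarrow> x \<otimes> z = z \<otimes> x"
  by (simp add: center_def commutant_def)

lemma center_assoc:
  "\<lbrakk>z \<in> center G; x \<in> carrier G; y \<in> carrier G\<rbrakk> \<Longrightarrow> (z \<otimes> x) \<otimes> y = z \<otimes> (x \<otimes> y)"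
  by (simp add: center_def nucleus_def)

text \<open>The middle nucleus condition brackets \<open>z\<close> with \<open>x\<close>, and
  commutation brings it to the front. With \<open>center_comm\<close> and
  \<open>center_assoc\<close> this makes three rules that pull a central factor to the front of any
  product.\<close>

lemma center_left_comm:
  assumes "z \<in> center G" "x \<in> carrier G" "y \<in> carrier G"
  shows "x \<otimes> (z \<otimes> y) = z \<otimes> (x \<otimes> y)"
proof -
  have "x \<otimes> (z \<otimes> y) = (x \<otimes> z) \<otimes> y"
    using assms by (simp add: center_def nucleus_def)
  then show ?thesis
    using assms by (simp add: center_comm[of z x] center_assoc)
qed

text \<open>Once \<open>z\<close> commutes with everything, the left, middle and right associativity
  conditions of the nucleus all reduce to moving \<open>z\<close> to the front, so
  \<open>assoc\<close> and \<open>left_comm\<close> cover all three.\<close>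

lemma centerI:
  assumes "z \<in> carrier G"
    and comm: "\<And>x. x \<in> carrier G \<Longrightarrow> x \<otimes> z = z \<otimes> x"
    and assoc: "\<And>x y. \<lbrakk>x \<in> carrier G; y \<in> carrier G\<rbrakk> \<Longrightarrow> (z \<otimes> x) \<otimes> y = z \<otimes> (x \<otimes> y)"
    and left_comm: "\<And>x y. \<lbrakk>x \<in> carrier G; y \<in> carrier G\<rbrakk> \<Longrightarrow> x \<otimes> (z \<otimes> y) = z \<otimes> (x \<otimes> y)"
  shows "z \<in> center G"
  using assms(1) unfolding center_def commutant_def nucleus_def
  by (auto simp: comm assoc left_comm m_closed)

text \<open>The center is not shown to be a group here, so the argument uses only the loop: the
  image of the neutral element is idempotent, and cancellation makes it
  \<open>\<one>\<close>.\<close>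

lemma hom_center_one:
  assumes "group Z" and "h \<in> hom Z (G\<lparr>carrier := center G\<rparr>)"
  shows "h \<one>\<^bsub>Z\<^esub> = \<one>"
proof -
  interpret Z: group Z by fact
  have "h \<one>\<^bsub>Z\<^esub> \<in> carrier G"
    using hom_in_carrier[OF assms(2) Z.one_closed] center_closed by simp
  moreover have "h \<one>\<^bsub>Z\<^esub> \<otimes> h \<one>\<^bsub>Z\<^esub> = h \<one>\<^bsub>Z\<^esub>"
    using hom_mult[OF assms(2) Z.one_closed Z.one_closed] by simp
  ultimately show ?thesis
    using l_cancel[of "h \<one>\<^bsub>Z\<^esub>" "h \<one>\<^bsub>Z\<^esub>" \<one>] one_closed r_one by simp
qed

lemma assoc_factor_in_min_center:
  assumes "a \<in> carrier G" "b \<in> carrier G" "c \<in> carrier G"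
  shows "assoc_factor G a b c \<in> min_center G"
  unfolding min_center_def using assms by (blast intro: generate.incl)

end

text \<open>Closure under both divisions makes \<open>H\<close> a loop. It also puts the associator
  of three elements of \<open>H\<close>, a right quotient of two products in \<open>H\<close>, into
  \<open>H\<close> itself; it stays central there because the defining conditions range over fewer
  elements.\<close>

lemma (in metagroup) submetagroupI:
  assumes sub: "H \<subseteq> carrier G" and one: "\<one> \<in> H"
    and mult: "\<And>x y. \<lbrakk>x \<in> H; y \<in> H\<rbrakk> \<Longrightarrow> x \<otimes> y \<in> H"
    and left: "\<And>x y. \<lbrakk>x \<in> H; y \<in> carrier G; x \<otimes> y \<in> H\<rbrakk> \<Longrightarrow> y \<in> H"
    and right: "\<And>x y. \<lbrakk>x \<in> H; y \<in> carrier G; y \<otimes> x \<in> H\<rbrakk> \<Longrightarrow> y \<in> H"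
  shows "submetagroup H G"
proof -
  let ?H = "G\<lparr>carrier := H\<rparr>"
  have in_G: "x \<in> H \<Longrightarrow> x \<in> carrier G" for x
    using sub by blast
  interpret H: loop ?H
  proof
    fix a b assume "a \<in> carrier ?H" "b \<in> carrier ?H"
    then have ab: "a \<in> H" "b \<in> H" by simp_all
    obtain x where "x \<in> carrier G" "a \<otimes> x = b"
      using left_division ab in_G by blast
    then show "\<exists>!x. x \<in> carrier ?H \<and> a \<otimes>\<^bsub>?H\<^esub> x = b"
      using left[of a x] ab in_G l_cancel[of a] by (intro ex1I[of _ x]) simp_all
    obtain y where "y \<in> carrier G" "y \<otimes> a = b"
      using right_division ab in_G by blast
    then show "\<exists>!y. y \<in> carrier ?H \<and> y \<otimes>\<^bsub>?H\<^esub> a = b"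
      using right[of a y] ab in_G r_cancel[of a] by (intro ex1I[of _ y]) simp_all
  qed (use one mult in_G l_one r_one in simp_all)
  have "metagroup ?H"
  proof
    fix a b c assume "a \<in> carrier ?H" "b \<in> carrier ?H" "c \<in> carrier ?H"
    then have abc: "a \<in> H" "b \<in> H" "c \<in> H" by simp_all
    let ?t = "assoc_factor G a b c"
    have t: "?t \<in> carrier G" "(a \<otimes> b) \<otimes> c = ?t \<otimes> (a \<otimes> (b \<otimes> c))"
      using assoc_factor_closed_eq abc in_G by blast+
    have tH: "?t \<in> H"
      using t abc mult right[of "a \<otimes> (b \<otimes> c)" ?t] by metis
    have tC: "?t \<in> center G"
      using assoc_factor_center abc in_G by blast
    have "assoc_factor ?H a b c = ?t"
      using H.assoc_factor_eqI[of a b c ?t] abc tH t by simp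
    moreover have "?t \<in> center ?H"
      using tH tC in_G by (intro H.centerI)
        (simp_all add: center_comm[of ?t] center_assoc[of ?t] center_left_comm[of ?t])
    ultimately show "assoc_factor ?H a b c \<in> center ?H"
      by simp
  qed
  then show ?thesis
    using sub by (simp add: submetagroup_def)
qed

section \<open>The smashed product\<close>

context smashing_data
begin

abbreviation C2 :: "('a \<times> 'b) monoid"
  where "C2 \<equiv> smashed_product A B \<iota>B \<Xi> \<phi> \<xi>"

abbreviation \<xi>_pair :: "'a \<times> 'b \<Rightarrow> 'a \<times> 'b \<Rightarrow> 'z"
  where "\<xi>_pair x y \<equiv> \<xi> (\<Xi> `` {x}) (\<Xi> `` {y})"

lemma carrier_C2: "carrier C2 = carrier A \<times> carrier B"
  by (simp add: smashed_product_def)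

lemma one_C2: "\<one>\<^bsub>C2\<^esub> = (\<one>\<^bsub>A\<^esub>, \<one>\<^bsub>B\<^esub>)"
  by (simp add: smashed_product_def)

lemma mult_C2: "(a, b) \<otimes>\<^bsub>C2\<^esub> (a', b') =
    (a \<otimes>\<^bsub>A\<^esub> a', \<iota>B (\<xi>_pair (a, b) (a', b')) \<otimes>\<^bsub>B\<^esub> (\<phi> a b' \<otimes>\<^bsub>B\<^esub> b))"
  by (simp add: smashed_product_def)

section \<open>Calculus of factors from \<open>Z\<close>\<close>

lemma \<iota>A_center: "\<gamma> \<in> carrier Z \<Longrightarrow> \<iota>A \<gamma> \<in> center A"
  using hom_in_carrier[OF \<iota>A_hom] by simp

lemma \<iota>B_center: "\<gamma> \<in> carrier Z \<Longrightarrow> \<iota>B \<gamma> \<in> center B"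
  using hom_in_carrier[OF \<iota>B_hom] by simp

lemma \<iota>A_closed: "\<gamma> \<in> carrier Z \<Longrightarrow> \<iota>A \<gamma> \<in> carrier A"
  by (rule A.center_closed[OF \<iota>A_center])

lemma \<iota>B_closed: "\<gamma> \<in> carrier Z \<Longrightarrow> \<iota>B \<gamma> \<in> carrier B"
  by (rule B.center_closed[OF \<iota>B_center])

lemma \<iota>B_mult: "\<lbrakk>\<gamma> \<in> carrier Z; \<delta> \<in> carrier Z\<rbrakk> \<Longrightarrow> \<iota>B (\<gamma> \<otimes>\<^bsub>Z\<^esub> \<delta>) = \<iota>B \<gamma> \<otimes>\<^bsub>B\<^esub> \<iota>B \<delta>"
  using hom_mult[OF \<iota>B_hom] by simp

lemma \<iota>A_one: "\<iota>A \<one>\<^bsub>Z\<^esub> = \<one>\<^bsub>A\<^esub>"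
  using A.hom_center_one[OF Z.is_group \<iota>A_hom] .

lemma \<iota>B_one: "\<iota>B \<one>\<^bsub>Z\<^esub> = \<one>\<^bsub>B\<^esub>"
  using B.hom_center_one[OF Z.is_group \<iota>B_hom] .

lemma \<iota>A_comm: "\<lbrakk>\<gamma> \<in> carrier Z; a \<in> carrier A\<rbrakk> \<Longrightarrow> a \<otimes>\<^bsub>A\<^esub> \<iota>A \<gamma> = \<iota>A \<gamma> \<otimes>\<^bsub>A\<^esub> a"
  by (rule A.center_comm[OF \<iota>A_center])

lemma \<iota>A_assoc: "\<lbrakk>\<gamma> \<in> carrier Z; a \<in> carrier A; b \<in> carrier A\<rbrakk> \<Longrightarrow>
    (\<iota>A \<gamma> \<otimes>\<^bsub>A\<^esub> a) \<otimes>\<^bsub>A\<^esub> b = \<iota>A \<gamma> \<otimes>\<^bsub>A\<^esub> (a \<otimes>\<^bsub>A\<^esub> b)"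
  by (rule A.center_assoc[OF \<iota>A_center])

lemma \<iota>A_left_comm: "\<lbrakk>\<gamma> \<in> carrier Z; a \<in> carrier A; b \<in> carrier A\<rbrakk> \<Longrightarrow>
    a \<otimes>\<^bsub>A\<^esub> (\<iota>A \<gamma> \<otimes>\<^bsub>A\<^esub> b) = \<iota>A \<gamma> \<otimes>\<^bsub>A\<^esub> (a \<otimes>\<^bsub>A\<^esub> b)"
  by (rule A.center_left_comm[OF \<iota>A_center])

lemma \<iota>B_comm: "\<lbrakk>\<gamma> \<in> carrier Z; b \<in> carrier B\<rbrakk> \<Longrightarrow> b \<otimes>\<^bsub>B\<^esub> \<iota>B \<gamma> = \<iota>B \<gamma> \<otimes>\<^bsub>B\<^esub> b"
  by (rule B.center_comm[OF \<iota>B_center])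

lemma \<iota>B_assoc: "\<lbrakk>\<gamma> \<in> carrier Z; b \<in> carrier B; c \<in> carrier B\<rbrakk> \<Longrightarrow>
    (\<iota>B \<gamma> \<otimes>\<^bsub>B\<^esub> b) \<otimes>\<^bsub>B\<^esub> c = \<iota>B \<gamma> \<otimes>\<^bsub>B\<^esub> (b \<otimes>\<^bsub>B\<^esub> c)"
  by (rule B.center_assoc[OF \<iota>B_center])

lemma \<iota>B_left_comm: "\<lbrakk>\<gamma> \<in> carrier Z; b \<in> carrier B; c \<in> carrier B\<rbrakk> \<Longrightarrow>
    b \<otimes>\<^bsub>B\<^esub> (\<iota>B \<gamma> \<otimes>\<^bsub>B\<^esub> c) = \<iota>B \<gamma> \<otimes>\<^bsub>B\<^esub> (b \<otimes>\<^bsub>B\<^esub> c)"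
  by (rule B.center_left_comm[OF \<iota>B_center])

lemma \<iota>B_\<iota>B:
  "\<lbrakk>\<gamma> \<in> carrier Z; \<delta> \<in> carrier Z; b \<in> carrier B\<rbrakk> \<Longrightarrow>
    \<iota>B \<gamma> \<otimes>\<^bsub>B\<^esub> (\<iota>B \<delta> \<otimes>\<^bsub>B\<^esub> b) = \<iota>B (\<gamma> \<otimes>\<^bsub>Z\<^esub> \<delta>) \<otimes>\<^bsub>B\<^esub> b"
  by (simp add: \<iota>B_mult \<iota>B_assoc \<iota>B_closed)

lemma \<iota>B_eq_iff:
  assumes "\<gamma> \<in> carrier Z" "b \<in> carrier B" "c \<in> carrier B"
  shows "\<iota>B \<gamma> \<otimes>\<^bsub>B\<^esub> b = c \<longleftrightarrow> b = \<iota>B (inv\<^bsub>Z\<^esub> \<gamma>) \<otimes>\<^bsub>B\<^esub> c"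
  using assms by (auto simp: \<iota>B_\<iota>B \<iota>B_one B.l_one)

lemma \<phi>_closed: "\<lbrakk>u \<in> carrier A; b \<in> carrier B\<rbrakk> \<Longrightarrow> \<phi> u b \<in> carrier B"
  using \<phi>_bij bij_betwE by blast

lemma \<xi>_pair_closed:
  "\<lbrakk>x \<in> carrier A \<times> carrier B; y \<in> carrier A \<times> carrier B\<rbrakk> \<Longrightarrow> \<xi>_pair x y \<in> carrier Z"
  by (intro \<xi>_closed quotientI)

lemmas closed = A.m_closed B.m_closed A.one_closed B.one_closed \<iota>A_closed \<iota>B_closed \<phi>_closed
  \<xi>_pair_closed \<eta>_closed \<kappa>_closed

text \<open>On classes a factor from \<open>Z\<close> moves from the second coordinate to the first,
  where \<open>\<xi>_central\<close> can remove it.\<close>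

lemma \<Xi>_class_central:
  assumes "u \<in> carrier A" "c \<in> carrier B" "\<beta> \<in> carrier Z"
  shows "\<Xi> `` {(u, \<iota>B \<beta> \<otimes>\<^bsub>B\<^esub> c)} = \<Xi> `` {(\<iota>A \<beta> \<otimes>\<^bsub>A\<^esub> u, c)}"
  using equiv_class_eq[OF \<Xi>_equiv \<Xi>_swap] assms by simp

lemma \<xi>_pair_central:
  assumes "u \<in> carrier A" "c \<in> carrier B" "v \<in> carrier A" "b \<in> carrier B"
    and "\<alpha> \<in> carrier Z" "\<beta> \<in> carrier Z"
  shows "\<xi>_pair (\<iota>A \<alpha> \<otimes>\<^bsub>A\<^esub> u, c) (v, b) = \<xi>_pair (u, c) (v, b)"
    and "\<xi>_pair (u, \<iota>B \<beta> \<otimes>\<^bsub>B\<^esub> c) (v, b) = \<xi>_pair (u, c) (v, b)"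
    and "\<xi>_pair (u, c) (\<iota>A \<alpha> \<otimes>\<^bsub>A\<^esub> v, b) = \<xi>_pair (u, c) (v, b)"
    and "\<xi>_pair (u, c) (v, \<iota>B \<beta> \<otimes>\<^bsub>B\<^esub> b) = \<xi>_pair (u, c) (v, b)"
  using assms by (simp_all add: \<Xi>_class_central closed \<xi>_central)

lemma \<xi>_pair_Z:
  assumes "v \<in> carrier A" "b \<in> carrier B" "\<alpha> \<in> carrier Z" "\<beta> \<in> carrier Z"
  shows "\<xi>_pair (\<iota>A \<alpha>, \<iota>B \<beta>) (v, b) = \<one>\<^bsub>Z\<^esub>"
    and "\<xi>_pair (v, b) (\<iota>A \<alpha>, \<iota>B \<beta>) = \<one>\<^bsub>Z\<^esub>"
proof -
  \<comment> \<open>Reading \<open>\<iota>B \<beta>\<close> as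
    \<open>\<iota>B \<beta> \<otimes> \<one>\<close> lets the factor be stripped, which leaves the
    pair handled by \<open>\<xi>_one_left\<close>.\<close>
  show "\<xi>_pair (\<iota>A \<alpha>, \<iota>B \<beta>) (v, b) = \<one>\<^bsub>Z\<^esub>"
    using \<xi>_pair_central(2)[of "\<iota>A \<alpha>" "\<one>\<^bsub>B\<^esub>" v b \<beta> \<beta>] assms
    by (simp add: closed B.r_one \<xi>_one_left)
  show "\<xi>_pair (v, b) (\<iota>A \<alpha>, \<iota>B \<beta>) = \<one>\<^bsub>Z\<^esub>"
    using \<xi>_pair_central(4)[of v b "\<iota>A \<alpha>" "\<one>\<^bsub>B\<^esub>" \<beta> \<beta>] assms
    by (simp add: closed B.r_one \<xi>_one_right)
qed

text \<open>The correction \<open>\<kappa>\<close> is trivial when the first factor comes from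
  \<open>Z\<close>, and \<open>\<phi> u\<close> fixes that factor.\<close>

lemma \<phi>_central:
  assumes "u \<in> carrier A" "b \<in> carrier B" "\<gamma> \<in> carrier Z"
  shows "\<phi> u (\<iota>B \<gamma> \<otimes>\<^bsub>B\<^esub> b) = \<iota>B \<gamma> \<otimes>\<^bsub>B\<^esub> \<phi> u b"
  using assms \<phi>_mult[of u "\<iota>B \<gamma>" b]
  by (simp add: closed \<kappa>_one \<phi>_fixes_Z \<iota>B_one B.r_one)

text \<open>Here \<open>\<xi>\<close> is trivial and \<open>\<phi> (\<iota>A \<alpha>)\<close> is
  the identity. The operation reverses the order in \<open>B\<close>, so the second coordinate first
  appears as \<open>q \<otimes> \<iota>B \<beta>\<close> and has to be commuted.\<close>

lemma Z_mult_C2: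
  assumes "p \<in> carrier A" "q \<in> carrier B" "\<alpha> \<in> carrier Z" "\<beta> \<in> carrier Z"
  shows "(\<iota>A \<alpha>, \<iota>B \<beta>) \<otimes>\<^bsub>C2\<^esub> (p, q) = (\<iota>A \<alpha> \<otimes>\<^bsub>A\<^esub> p, \<iota>B \<beta> \<otimes>\<^bsub>B\<^esub> q)"
  using assms by (simp add: mult_C2 \<xi>_pair_Z \<phi>_Z_trivial \<iota>B_one B.l_one closed
      \<iota>B_comm[of _ q])

lemma mult_Z_C2:
  assumes "p \<in> carrier A" "q \<in> carrier B" "\<alpha> \<in> carrier Z" "\<beta> \<in> carrier Z"
  shows "(p, q) \<otimes>\<^bsub>C2\<^esub> (\<iota>A \<alpha>, \<iota>B \<beta>) = (\<iota>A \<alpha> \<otimes>\<^bsub>A\<^esub> p, \<iota>B \<beta> \<otimes>\<^bsub>B\<^esub> q)"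
  using assms by (simp add: mult_C2 \<xi>_pair_Z \<phi>_fixes_Z \<iota>B_one B.l_one closed
      \<iota>A_comm[of _ p])

section \<open>Unique division in the smashed product\<close>

lemma left_division_C2:
  assumes "a \<in> carrier A" "b \<in> carrier B" "p \<in> carrier A" "q \<in> carrier B"
  shows "\<exists>!x. x \<in> carrier C2 \<and> (a, b) \<otimes>\<^bsub>C2\<^esub> x = (p, q)"
proof -
  obtain v where v: "v \<in> carrier A" "a \<otimes>\<^bsub>A\<^esub> v = p"
    using A.left_division assms by metis
  \<comment> \<open>The elements \<open>y\<close> and \<open>c\<close> solve the equation of second
    coordinates with \<open>\<xi>\<close> left out: \<open>\<phi> a c \<otimes> b = q\<close>. Since
    the operation reverses the order in \<open>B\<close>, this calls for right division
    there.\<close>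
  obtain y where y: "y \<in> carrier B" "y \<otimes>\<^bsub>B\<^esub> b = q"
    using B.right_division assms by metis
  obtain c where c: "c \<in> carrier B" "\<phi> a c = y"
    using \<phi>_bij[OF assms(1)] y by (metis bij_betw_iff_bijections)
  have inj: "inj_on (\<phi> a) (carrier B)"
    using \<phi>_bij[OF assms(1)] by (rule bij_betw_imp_inj_on)
  let ?\<gamma> = "\<xi>_pair (a, b) (v, c)"
  have \<gamma>: "?\<gamma> \<in> carrier Z"
    using assms v c by (simp add: closed)
  \<comment> \<open>The right-hand side still contains \<open>d\<close> inside \<open>\<xi>\<close>,
    so this is a fixed-point equation. It arises by absorbing the factor
    \<open>\<iota>B ?\<delta>\<close> into the argument of \<open>\<phi> a\<close> and cancelling
    \<open>b\<close> and \<open>\<phi> a\<close>.\<close>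
  have solve: "(a, b) \<otimes>\<^bsub>C2\<^esub> (v, d) = (p, q) \<longleftrightarrow> d = \<iota>B (inv\<^bsub>Z\<^esub> \<xi>_pair (a, b) (v, d)) \<otimes>\<^bsub>B\<^esub> c"
    if d: "d \<in> carrier B" for d
  proof -
    let ?\<delta> = "\<xi>_pair (a, b) (v, d)"
    have \<delta>: "?\<delta> \<in> carrier Z"
      using assms v d by (simp add: closed)
    have "\<iota>B ?\<delta> \<otimes>\<^bsub>B\<^esub> (\<phi> a d \<otimes>\<^bsub>B\<^esub> b) = \<phi> a (\<iota>B ?\<delta> \<otimes>\<^bsub>B\<^esub> d) \<otimes>\<^bsub>B\<^esub> b"
      using assms d \<delta> by (simp add: \<phi>_central \<iota>B_assoc closed)
    then have "(a, b) \<otimes>\<^bsub>C2\<^esub> (v, d) = (p, q) \<longleftrightarrow> \<phi> a (\<iota>B ?\<delta> \<otimes>\<^bsub>B\<^esub> d) \<otimes>\<^bsub>B\<^esub> b = y \<otimes>\<^bsub>B\<^esub> b"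
      using v y by (simp add: mult_C2)
    also have "\<dots> \<longleftrightarrow> \<phi> a (\<iota>B ?\<delta> \<otimes>\<^bsub>B\<^esub> d) = \<phi> a c"
      using B.r_cancel[of b "\<phi> a (\<iota>B ?\<delta> \<otimes>\<^bsub>B\<^esub> d)" y] assms d \<delta> y c by (auto simp: closed)
    also have "\<dots> \<longleftrightarrow> \<iota>B ?\<delta> \<otimes>\<^bsub>B\<^esub> d = c"
      by (rule inj_on_eq_iff[OF inj]) (use d \<delta> c in \<open>simp_all add: closed\<close>)
    also have "\<dots> \<longleftrightarrow> d = \<iota>B (inv\<^bsub>Z\<^esub> ?\<delta>) \<otimes>\<^bsub>B\<^esub> c"
      using \<iota>B_eq_iff \<delta> d c by simp
    finally show ?thesis .
  qed
  let ?d = "\<iota>B (inv\<^bsub>Z\<^esub> ?\<gamma>) \<otimes>\<^bsub>B\<^esub> c"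
  have dB: "?d \<in> carrier B"
    using \<gamma> c by (simp add: closed)
  show ?thesis
  proof (rule ex1I[of _ "(v, ?d)"])
    \<comment> \<open>Because \<open>?d\<close> is \<open>c\<close> times a factor from
      \<open>Z\<close>, \<open>\<xi>\<close> takes the same value at both, and \<open>?d\<close>
      satisfies the fixed-point equation.\<close>
    show "(v, ?d) \<in> carrier C2 \<and> (a, b) \<otimes>\<^bsub>C2\<^esub> (v, ?d) = (p, q)"
      using solve[OF dB] dB v assms c \<gamma> by (simp add: carrier_C2 \<xi>_pair_central)
  next
    fix x assume x: "x \<in> carrier C2 \<and> (a, b) \<otimes>\<^bsub>C2\<^esub> x = (p, q)"
    obtain v' d where vd: "x = (v', d)" "v' \<in> carrier A" "d \<in> carrier B"
      using x by (auto simp: carrier_C2)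
    have "v' = v"
      using x vd v assms A.l_cancel[of a v' v] by (simp add: mult_C2)
    then have d: "d = \<iota>B (inv\<^bsub>Z\<^esub> \<xi>_pair (a, b) (v, d)) \<otimes>\<^bsub>B\<^esub> c"
      using solve[of d] x vd by simp
    have "\<xi>_pair (a, b) (v, d) \<in> carrier Z"
      using assms v vd by (simp add: closed)
    \<comment> \<open>By its own fixed-point equation every solution \<open>d\<close> is a multiple
      of \<open>c\<close> by a factor from \<open>Z\<close>, so its value of \<open>\<xi>\<close> is
      forced to be \<open>?\<gamma>\<close>.\<close>
    then have "\<xi>_pair (a, b) (v, d) = ?\<gamma>"
      by (subst d) (use assms v c in \<open>simp add: \<xi>_pair_central\<close>)
    then show "x = (v, ?d)"
      using d vd \<open>v' = v\<close> by simp
  qed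
qed

text \<open>The scheme is that of left division, with the roles in \<open>B\<close> exchanged. Once
  the first coordinate \<open>u\<close> is found, \<open>\<phi> u b\<close> is a known left factor,
  so left division in \<open>B\<close> takes the place of inverting \<open>\<phi>\<close>.\<close>

lemma right_division_C2:
  assumes "a \<in> carrier A" "b \<in> carrier B" "p \<in> carrier A" "q \<in> carrier B"
  shows "\<exists>!x. x \<in> carrier C2 \<and> x \<otimes>\<^bsub>C2\<^esub> (a, b) = (p, q)"
proof -
  obtain u where u: "u \<in> carrier A" "u \<otimes>\<^bsub>A\<^esub> a = p"
    using A.right_division assms by metis
  obtain c where c: "c \<in> carrier B" "\<phi> u b \<otimes>\<^bsub>B\<^esub> c = q"
    using B.left_division assms u by (metis \<phi>_closed)
  let ?\<gamma> = "\<xi>_pair (u, c) (a, b)"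
  have \<gamma>: "?\<gamma> \<in> carrier Z"
    using assms u c by (simp add: closed)
  have solve: "(u, d) \<otimes>\<^bsub>C2\<^esub> (a, b) = (p, q) \<longleftrightarrow> d = \<iota>B (inv\<^bsub>Z\<^esub> \<xi>_pair (u, d) (a, b)) \<otimes>\<^bsub>B\<^esub> c"
    if d: "d \<in> carrier B" for d
  proof -
    let ?\<delta> = "\<xi>_pair (u, d) (a, b)"
    have \<delta>: "?\<delta> \<in> carrier Z"
      using assms u d by (simp add: closed)
    have "\<iota>B ?\<delta> \<otimes>\<^bsub>B\<^esub> (\<phi> u b \<otimes>\<^bsub>B\<^esub> d) = \<phi> u b \<otimes>\<^bsub>B\<^esub> (\<iota>B ?\<delta> \<otimes>\<^bsub>B\<^esub> d)"
      using assms u d \<delta> by (simp add: \<iota>B_left_comm[of _ "\<phi> u b"] closed)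
    then have "(u, d) \<otimes>\<^bsub>C2\<^esub> (a, b) = (p, q) \<longleftrightarrow>
        \<phi> u b \<otimes>\<^bsub>B\<^esub> (\<iota>B ?\<delta> \<otimes>\<^bsub>B\<^esub> d) = \<phi> u b \<otimes>\<^bsub>B\<^esub> c"
      using u c by (simp add: mult_C2)
    also have "\<dots> \<longleftrightarrow> \<iota>B ?\<delta> \<otimes>\<^bsub>B\<^esub> d = c"
      using B.l_cancel[of "\<phi> u b" "\<iota>B ?\<delta> \<otimes>\<^bsub>B\<^esub> d" c] assms u d \<delta> c by (auto simp: closed)
    also have "\<dots> \<longleftrightarrow> d = \<iota>B (inv\<^bsub>Z\<^esub> ?\<delta>) \<otimes>\<^bsub>B\<^esub> c"
      using \<iota>B_eq_iff \<delta> d c by simp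
    finally show ?thesis .
  qed
  let ?d = "\<iota>B (inv\<^bsub>Z\<^esub> ?\<gamma>) \<otimes>\<^bsub>B\<^esub> c"
  have dB: "?d \<in> carrier B"
    using \<gamma> c by (simp add: closed)
  show ?thesis
  proof (rule ex1I[of _ "(u, ?d)"])
    show "(u, ?d) \<in> carrier C2 \<and> (u, ?d) \<otimes>\<^bsub>C2\<^esub> (a, b) = (p, q)"
      using solve[OF dB] dB u assms c \<gamma> by (simp add: carrier_C2 \<xi>_pair_central)
  next
    fix x assume x: "x \<in> carrier C2 \<and> x \<otimes>\<^bsub>C2\<^esub> (a, b) = (p, q)"
    obtain u' d where ud: "x = (u', d)" "u' \<in> carrier A" "d \<in> carrier B"
      using x by (auto simp: carrier_C2)
    have "u' = u"
      using x ud u assms A.r_cancel[of a u' u] by (simp add: mult_C2)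
    then have d: "d = \<iota>B (inv\<^bsub>Z\<^esub> \<xi>_pair (u, d) (a, b)) \<otimes>\<^bsub>B\<^esub> c"
      using solve[of d] x ud by simp
    have "\<xi>_pair (u, d) (a, b) \<in> carrier Z"
      using assms u ud by (simp add: closed)
    then have "\<xi>_pair (u, d) (a, b) = ?\<gamma>"
      by (subst d) (use assms u c in \<open>simp add: \<xi>_pair_central\<close>)
    then show "x = (u, ?d)"
      using d ud \<open>u' = u\<close> by simp
  qed
qed

lemma loop_C2: "loop C2"
proof
  show "\<one>\<^bsub>C2\<^esub> \<in> carrier C2"
    by (simp add: carrier_C2 one_C2 closed)
  fix x assume "x \<in> carrier C2"
  then obtain a b where x: "x = (a, b)" "a \<in> carrier A" "b \<in> carrier B"
    by (auto simp: carrier_C2)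
  \<comment> \<open>The neutral pair is the image of \<open>\<one>\<close> under both embeddings of
    \<open>Z\<close>, so neutrality is a case of the rules for pairs from \<open>Z\<close>.\<close>
  show "\<one>\<^bsub>C2\<^esub> \<otimes>\<^bsub>C2\<^esub> x = x"
    using Z_mult_C2[of a b "\<one>\<^bsub>Z\<^esub>" "\<one>\<^bsub>Z\<^esub>"] x
    by (simp add: one_C2 \<iota>A_one \<iota>B_one A.l_one B.l_one)
  show "x \<otimes>\<^bsub>C2\<^esub> \<one>\<^bsub>C2\<^esub> = x"
    using mult_Z_C2[of a b "\<one>\<^bsub>Z\<^esub>" "\<one>\<^bsub>Z\<^esub>"] x
    by (simp add: one_C2 \<iota>A_one \<iota>B_one A.l_one B.l_one)
  fix y assume "y \<in> carrier C2"
  then obtain p q where y: "y = (p, q)" "p \<in> carrier A" "q \<in> carrier B"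
    by (auto simp: carrier_C2)
  show "x \<otimes>\<^bsub>C2\<^esub> y \<in> carrier C2"
    using x y by (simp add: carrier_C2 mult_C2 closed)
  show "\<exists>!z. z \<in> carrier C2 \<and> x \<otimes>\<^bsub>C2\<^esub> z = y"
    using left_division_C2 x y by simp
  show "\<exists>!z. z \<in> carrier C2 \<and> z \<otimes>\<^bsub>C2\<^esub> x = y"
    using right_division_C2 x y by simp
qed

section \<open>Central elements and associators of the smashed product\<close>

text \<open>The triviality of \<open>\<eta>\<close> enters where the pair stands leftmost in a
  product bracketed to the left: there \<open>\<iota>A \<alpha>\<close> is multiplied into the
  element whose \<open>\<phi>\<close> acts on the next factor.\<close>

lemma Z_in_center_C2:
  assumes \<alpha>: "\<alpha> \<in> carrier Z" and \<beta>: "\<beta> \<in> carrier Z"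
    and \<eta>_trivial: "\<And>u b. \<lbrakk>u \<in> carrier A; b \<in> carrier B\<rbrakk> \<Longrightarrow> \<eta> (\<iota>A \<alpha>) u b = \<one>\<^bsub>Z\<^esub>"
  shows "(\<iota>A \<alpha>, \<iota>B \<beta>) \<in> center C2"
proof -
  interpret C2: loop C2 by (rule loop_C2)
  \<comment> \<open>In \<open>\<phi>_\<phi>\<close> the outer map is
    \<open>\<phi> (\<iota>A \<alpha>)\<close>, the identity, so only the trivial factor
    \<open>\<eta>\<close> could separate the two sides.\<close>
  have \<phi>: "\<phi> (\<iota>A \<alpha> \<otimes>\<^bsub>A\<^esub> u) b = \<phi> u b" if "u \<in> carrier A" "b \<in> carrier B" for u b
    using that \<phi>_\<phi>[of u "\<iota>A \<alpha>" b] \<alpha>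
    by (simp add: \<eta>_trivial \<iota>B_one B.r_one \<phi>_Z_trivial closed)
  show ?thesis
  proof (rule C2.centerI)
    show "(\<iota>A \<alpha>, \<iota>B \<beta>) \<in> carrier C2"
      using \<alpha> \<beta> by (simp add: carrier_C2 closed)
    fix x assume "x \<in> carrier C2"
    then obtain a b where x: "x = (a, b)" "a \<in> carrier A" "b \<in> carrier B"
      by (auto simp: carrier_C2)
    show "x \<otimes>\<^bsub>C2\<^esub> (\<iota>A \<alpha>, \<iota>B \<beta>) = (\<iota>A \<alpha>, \<iota>B \<beta>) \<otimes>\<^bsub>C2\<^esub> x"
      using x \<alpha> \<beta> by (simp add: mult_Z_C2 Z_mult_C2)
    fix y assume "y \<in> carrier C2"
    then obtain p q where y: "y = (p, q)" "p \<in> carrier A" "q \<in> carrier B"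
      by (auto simp: carrier_C2)
    have \<gamma>: "\<xi>_pair (a, b) (p, q) \<in> carrier Z"
      using x y by (simp add: closed)
    \<comment> \<open>Common normal form of the three bracketings, with all factors from
      \<open>Z\<close> collected in front.\<close>
    let ?t = "(\<iota>A \<alpha> \<otimes>\<^bsub>A\<^esub> (a \<otimes>\<^bsub>A\<^esub> p),
      \<iota>B (\<xi>_pair (a, b) (p, q) \<otimes>\<^bsub>Z\<^esub> \<beta>) \<otimes>\<^bsub>B\<^esub> (\<phi> a q \<otimes>\<^bsub>B\<^esub> b))"
    have t: "(\<iota>A \<alpha>, \<iota>B \<beta>) \<otimes>\<^bsub>C2\<^esub> (x \<otimes>\<^bsub>C2\<^esub> y) = ?t"
      using x y \<alpha> \<beta> \<gamma> by (simp add: mult_C2[of a b] Z_mult_C2 closed \<iota>B_\<iota>B Z.m_comm)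
    have "((\<iota>A \<alpha>, \<iota>B \<beta>) \<otimes>\<^bsub>C2\<^esub> x) \<otimes>\<^bsub>C2\<^esub> y = ?t"
      using x y \<alpha> \<beta> \<gamma> by (simp add: Z_mult_C2 mult_C2[of "\<iota>A \<alpha> \<otimes>\<^bsub>A\<^esub> a"] closed \<xi>_pair_central \<phi>
          \<iota>A_assoc \<iota>B_left_comm[of _ "\<phi> a q"] \<iota>B_\<iota>B)
    then show "((\<iota>A \<alpha>, \<iota>B \<beta>) \<otimes>\<^bsub>C2\<^esub> x) \<otimes>\<^bsub>C2\<^esub> y = (\<iota>A \<alpha>, \<iota>B \<beta>) \<otimes>\<^bsub>C2\<^esub> (x \<otimes>\<^bsub>C2\<^esub> y)"
      by (simp add: t)
    have "x \<otimes>\<^bsub>C2\<^esub> ((\<iota>A \<alpha>, \<iota>B \<beta>) \<otimes>\<^bsub>C2\<^esub> y) = ?t"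
      using x y \<alpha> \<beta> \<gamma> by (simp add: Z_mult_C2 mult_C2[of a b] closed \<xi>_pair_central \<phi>_central
          \<iota>A_left_comm[of _ a] \<iota>B_assoc \<iota>B_\<iota>B)
    then show "x \<otimes>\<^bsub>C2\<^esub> ((\<iota>A \<alpha>, \<iota>B \<beta>) \<otimes>\<^bsub>C2\<^esub> y) = (\<iota>A \<alpha>, \<iota>B \<beta>) \<otimes>\<^bsub>C2\<^esub> (x \<otimes>\<^bsub>C2\<^esub> y)"
      by (simp add: t)
  qed
qed

text \<open>In both bracketings the second coordinate is a multiple of the same element
  \<open>?w\<close> by a factor from \<open>Z\<close>, so \<open>\<beta>\<close> is the quotient of
  the two factors. Centrality of the resulting pair is a separate matter.\<close>

lemma assoc_C2:
  assumes a: "a1 \<in> carrier A" "a2 \<in> carrier A" "a3 \<in> carrier A"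
    and b: "b1 \<in> carrier B" "b2 \<in> carrier B" "b3 \<in> carrier B"
    and \<alpha>: "\<alpha> \<in> carrier Z" "assoc_factor A a1 a2 a3 = \<iota>A \<alpha>"
  shows "\<exists>\<beta> \<in> carrier Z. ((a1, b1) \<otimes>\<^bsub>C2\<^esub> (a2, b2)) \<otimes>\<^bsub>C2\<^esub> (a3, b3) =
    (\<iota>A \<alpha>, \<iota>B \<beta>) \<otimes>\<^bsub>C2\<^esub> ((a1, b1) \<otimes>\<^bsub>C2\<^esub> ((a2, b2) \<otimes>\<^bsub>C2\<^esub> (a3, b3)))"
proof -
  let ?x1 = "(a1, b1)" and ?x2 = "(a2, b2)" and ?x3 = "(a3, b3)"
  \<comment> \<open>These are the contributions of \<open>b3\<close> and \<open>b2\<close>.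
    Bracketing to the left produces \<open>x \<otimes> (y \<otimes> b1)\<close>, bracketing to the
    right produces \<open>(x \<otimes> y) \<otimes> b1\<close>; the associator \<open>\<tau>\<close>
    in \<open>B\<close> reconciles them.\<close>
  define x y where "x = \<phi> (a1 \<otimes>\<^bsub>A\<^esub> a2) b3" and "y = \<phi> a1 b2"
  have xy: "x \<in> carrier B" "y \<in> carrier B"
    using a b by (simp_all add: x_def y_def closed)
  let ?w = "x \<otimes>\<^bsub>B\<^esub> (y \<otimes>\<^bsub>B\<^esub> b1)"
  have w: "?w \<in> carrier B"
    using xy b by (simp add: closed)
  have "assoc_factor B x y b1 \<in> \<iota>B ` carrier Z"
    using B.assoc_factor_in_min_center min_center_B xy b by blast
  then obtain \<tau> where \<tau>: "\<tau> \<in> carrier Z" "assoc_factor B x y b1 = \<iota>B \<tau>"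
    by blast
  have xyb: "(x \<otimes>\<^bsub>B\<^esub> y) \<otimes>\<^bsub>B\<^esub> b1 = \<iota>B \<tau> \<otimes>\<^bsub>B\<^esub> ?w"
    using B.assoc_factor_closed_eq[of x y b1] xy b \<tau> by simp
  let ?\<gamma>12 = "\<xi>_pair ?x1 ?x2" and ?\<gamma>23 = "\<xi>_pair ?x2 ?x3"
  have \<gamma>: "?\<gamma>12 \<in> carrier Z" "?\<gamma>23 \<in> carrier Z"
    using a b by (simp_all add: closed)
  have C2_closed: "?x1 \<otimes>\<^bsub>C2\<^esub> ?x2 \<in> carrier A \<times> carrier B" "?x2 \<otimes>\<^bsub>C2\<^esub> ?x3 \<in> carrier A \<times> carrier B"
    using a b by (simp_all add: mult_C2 closed)
  define \<gamma>12_3 \<gamma>1_23 where "\<gamma>12_3 = \<xi>_pair (?x1 \<otimes>\<^bsub>C2\<^esub> ?x2) ?x3"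
    and "\<gamma>1_23 = \<xi>_pair ?x1 (?x2 \<otimes>\<^bsub>C2\<^esub> ?x3)"
  have \<gamma>': "\<gamma>12_3 \<in> carrier Z" "\<gamma>1_23 \<in> carrier Z"
    using C2_closed a b by (simp_all add: \<gamma>12_3_def \<gamma>1_23_def \<xi>_pair_closed)
  let ?\<eta> = "\<eta> a1 a2 b3" and ?\<kappa> = "\<kappa> a1 (\<phi> a2 b3) b2"
  have \<eta>\<kappa>: "?\<eta> \<in> carrier Z" "?\<kappa> \<in> carrier Z"
    using a b by (simp_all add: closed)
  \<comment> \<open>\<open>\<beta>1\<close> and \<open>\<beta>2\<close> collect the factors from
    \<open>Z\<close> in the left and in the right bracketing. Only the second one applies
    \<open>\<phi> a1\<close> to a product containing \<open>\<phi> a2 b3\<close>, hence its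
    \<open>\<kappa>\<close> and \<open>\<eta>\<close>.\<close>
  define \<beta>1 \<beta>2 where "\<beta>1 = \<gamma>12_3 \<otimes>\<^bsub>Z\<^esub> ?\<gamma>12"
    and "\<beta>2 = \<gamma>1_23 \<otimes>\<^bsub>Z\<^esub> (?\<gamma>23 \<otimes>\<^bsub>Z\<^esub> (?\<kappa> \<otimes>\<^bsub>Z\<^esub> (?\<eta> \<otimes>\<^bsub>Z\<^esub> \<tau>)))"
  have \<beta>: "\<beta>1 \<in> carrier Z" "\<beta>2 \<in> carrier Z"
    using \<gamma> \<gamma>' \<eta>\<kappa> \<tau> by (simp_all add: \<beta>1_def \<beta>2_def)
  have lhs: "(?x1 \<otimes>\<^bsub>C2\<^esub> ?x2) \<otimes>\<^bsub>C2\<^esub> ?x3 = ((a1 \<otimes>\<^bsub>A\<^esub> a2) \<otimes>\<^bsub>A\<^esub> a3, \<iota>B \<beta>1 \<otimes>\<^bsub>B\<^esub> ?w)"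
  proof -
    have "(?x1 \<otimes>\<^bsub>C2\<^esub> ?x2) \<otimes>\<^bsub>C2\<^esub> ?x3 =
        ((a1 \<otimes>\<^bsub>A\<^esub> a2) \<otimes>\<^bsub>A\<^esub> a3, \<iota>B \<gamma>12_3 \<otimes>\<^bsub>B\<^esub> (x \<otimes>\<^bsub>B\<^esub> (\<iota>B ?\<gamma>12 \<otimes>\<^bsub>B\<^esub> (y \<otimes>\<^bsub>B\<^esub> b1))))"
      by (simp add: mult_C2 x_def y_def \<gamma>12_3_def)
    also have "x \<otimes>\<^bsub>B\<^esub> (\<iota>B ?\<gamma>12 \<otimes>\<^bsub>B\<^esub> (y \<otimes>\<^bsub>B\<^esub> b1)) = \<iota>B ?\<gamma>12 \<otimes>\<^bsub>B\<^esub> ?w"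
      using \<gamma> xy b by (simp add: \<iota>B_left_comm[of _ x] closed)
    also have "\<iota>B \<gamma>12_3 \<otimes>\<^bsub>B\<^esub> (\<iota>B ?\<gamma>12 \<otimes>\<^bsub>B\<^esub> ?w) = \<iota>B \<beta>1 \<otimes>\<^bsub>B\<^esub> ?w"
      using \<gamma> \<gamma>' w by (simp add: \<iota>B_\<iota>B \<beta>1_def)
    finally show ?thesis .
  qed
  have rhs: "?x1 \<otimes>\<^bsub>C2\<^esub> (?x2 \<otimes>\<^bsub>C2\<^esub> ?x3) = (a1 \<otimes>\<^bsub>A\<^esub> (a2 \<otimes>\<^bsub>A\<^esub> a3), \<iota>B \<beta>2 \<otimes>\<^bsub>B\<^esub> ?w)"
  proof -
    have "\<phi> a1 (\<phi> a2 b3 \<otimes>\<^bsub>B\<^esub> b2) = ((x \<otimes>\<^bsub>B\<^esub> \<iota>B ?\<eta>) \<otimes>\<^bsub>B\<^esub> y) \<otimes>\<^bsub>B\<^esub> \<iota>B ?\<kappa>"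
      using a b by (simp add: \<phi>_mult \<phi>_\<phi> closed x_def y_def)
    also have "\<dots> = \<iota>B ?\<kappa> \<otimes>\<^bsub>B\<^esub> (\<iota>B ?\<eta> \<otimes>\<^bsub>B\<^esub> (x \<otimes>\<^bsub>B\<^esub> y))"
      using \<eta>\<kappa> xy by (simp add: \<iota>B_comm[of _ x] \<iota>B_comm[of ?\<kappa>] \<iota>B_assoc closed)
    finally have \<phi>: "\<phi> a1 (\<phi> a2 b3 \<otimes>\<^bsub>B\<^esub> b2) = \<iota>B ?\<kappa> \<otimes>\<^bsub>B\<^esub> (\<iota>B ?\<eta> \<otimes>\<^bsub>B\<^esub> (x \<otimes>\<^bsub>B\<^esub> y))" .
    have "?x1 \<otimes>\<^bsub>C2\<^esub> (?x2 \<otimes>\<^bsub>C2\<^esub> ?x3) = (a1 \<otimes>\<^bsub>A\<^esub> (a2 \<otimes>\<^bsub>A\<^esub> a3),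
        \<iota>B \<gamma>1_23 \<otimes>\<^bsub>B\<^esub> (\<phi> a1 (\<iota>B ?\<gamma>23 \<otimes>\<^bsub>B\<^esub> (\<phi> a2 b3 \<otimes>\<^bsub>B\<^esub> b2)) \<otimes>\<^bsub>B\<^esub> b1))"
      by (simp add: mult_C2 \<gamma>1_23_def)
    also have "\<phi> a1 (\<iota>B ?\<gamma>23 \<otimes>\<^bsub>B\<^esub> (\<phi> a2 b3 \<otimes>\<^bsub>B\<^esub> b2)) =
        \<iota>B ?\<gamma>23 \<otimes>\<^bsub>B\<^esub> (\<iota>B ?\<kappa> \<otimes>\<^bsub>B\<^esub> (\<iota>B ?\<eta> \<otimes>\<^bsub>B\<^esub> (x \<otimes>\<^bsub>B\<^esub> y)))"
      using a b \<gamma> by (simp add: \<phi>_central closed \<phi>)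
    also have "\<dots> \<otimes>\<^bsub>B\<^esub> b1 =
        \<iota>B ?\<gamma>23 \<otimes>\<^bsub>B\<^esub> (\<iota>B ?\<kappa> \<otimes>\<^bsub>B\<^esub> (\<iota>B ?\<eta> \<otimes>\<^bsub>B\<^esub> (\<iota>B \<tau> \<otimes>\<^bsub>B\<^esub> ?w)))"
      using \<gamma> \<eta>\<kappa> xy b by (simp add: \<iota>B_assoc closed xyb)
    also have "\<iota>B \<gamma>1_23 \<otimes>\<^bsub>B\<^esub> \<dots> = \<iota>B \<beta>2 \<otimes>\<^bsub>B\<^esub> ?w"
      using \<gamma> \<gamma>' \<eta>\<kappa> \<tau> w by (simp add: \<iota>B_\<iota>B \<beta>2_def closed Z.m_assoc)
    finally show ?thesis .
  qed
  have "(a1 \<otimes>\<^bsub>A\<^esub> a2) \<otimes>\<^bsub>A\<^esub> a3 = \<iota>A \<alpha> \<otimes>\<^bsub>A\<^esub> (a1 \<otimes>\<^bsub>A\<^esub> (a2 \<otimes>\<^bsub>A\<^esub> a3))"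
    using A.assoc_factor_closed_eq[of a1 a2 a3] a \<alpha> by simp
  moreover have "\<iota>B \<beta>1 \<otimes>\<^bsub>B\<^esub> ?w = \<iota>B (\<beta>1 \<otimes>\<^bsub>Z\<^esub> inv\<^bsub>Z\<^esub> \<beta>2) \<otimes>\<^bsub>B\<^esub> (\<iota>B \<beta>2 \<otimes>\<^bsub>B\<^esub> ?w)"
    using \<beta> w by (simp add: \<iota>B_\<iota>B Z.m_assoc)
  ultimately have "(?x1 \<otimes>\<^bsub>C2\<^esub> ?x2) \<otimes>\<^bsub>C2\<^esub> ?x3 =
      (\<iota>A \<alpha>, \<iota>B (\<beta>1 \<otimes>\<^bsub>Z\<^esub> inv\<^bsub>Z\<^esub> \<beta>2)) \<otimes>\<^bsub>C2\<^esub> (?x1 \<otimes>\<^bsub>C2\<^esub> (?x2 \<otimes>\<^bsub>C2\<^esub> ?x3))"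
    using a \<alpha> \<beta> w unfolding lhs rhs by (simp add: Z_mult_C2 closed)
  then show ?thesis
    using \<beta> by blast
qed

lemma metagroup_C2:
  assumes \<eta>_trivial: "\<And>\<gamma> u b. \<lbrakk>\<gamma> \<in> carrier Z; \<iota>A \<gamma> \<in> min_center A; u \<in> carrier A; b \<in> carrier B\<rbrakk>
    \<Longrightarrow> \<eta> (\<iota>A \<gamma>) u b = \<one>\<^bsub>Z\<^esub>"
  shows "metagroup C2"
proof -
  interpret C2: loop C2 by (rule loop_C2)
  show ?thesis
  proof
    fix x1 x2 x3 assume x_in: "x1 \<in> carrier C2" "x2 \<in> carrier C2" "x3 \<in> carrier C2"
    then obtain a1 b1 a2 b2 a3 b3 where x: "x1 = (a1, b1)" "x2 = (a2, b2)" "x3 = (a3, b3)"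
      and a: "a1 \<in> carrier A" "a2 \<in> carrier A" "a3 \<in> carrier A"
      and b: "b1 \<in> carrier B" "b2 \<in> carrier B" "b3 \<in> carrier B"
      by (auto simp: carrier_C2)
    \<comment> \<open>Recorded because \<open>\<eta>_trivial\<close> is assumed only for elements of
      \<open>min_center A\<close>, and the first coordinate of the associator in \<open>C2\<close>
      is this element.\<close>
    have mc: "assoc_factor A a1 a2 a3 \<in> min_center A"
      using A.assoc_factor_in_min_center a by blast
    then obtain \<alpha> where \<alpha>: "\<alpha> \<in> carrier Z" "assoc_factor A a1 a2 a3 = \<iota>A \<alpha>"
      using min_center_A by blast
    obtain \<beta> where \<beta>: "\<beta> \<in> carrier Z"
      and eq: "(x1 \<otimes>\<^bsub>C2\<^esub> x2) \<otimes>\<^bsub>C2\<^esub> x3 = (\<iota>A \<alpha>, \<iota>B \<beta>) \<otimes>\<^bsub>C2\<^esub> (x1 \<otimes>\<^bsub>C2\<^esub> (x2 \<otimes>\<^bsub>C2\<^esub> x3))"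
      using assoc_C2[OF a b \<alpha>] x by blast
    have "(\<iota>A \<alpha>, \<iota>B \<beta>) \<in> center C2"
      using Z_in_center_C2 \<alpha> \<beta> mc \<eta>_trivial by simp
    then show "assoc_factor C2 x1 x2 x3 \<in> center C2"
      using C2.assoc_factor_eqI[OF x_in C2.center_closed eq] by simp
  qed
qed

section \<open>Cosets of \<open>B\<close> as fibres over \<open>A\<close>\<close>

text \<open>Division in \<open>C2\<close> yields a preimage for each point of the target fibre, and
  cancellation in \<open>A\<close> forces its first coordinate to be \<open>p\<close>. The fibre
  over an arbitrary \<open>p\<close> is treated because normality involves iterated cosets.\<close>

lemma l_coset_fibre:
  assumes "a \<in> carrier A" "b \<in> carrier B" "p \<in> carrier A"
  shows "(a, b) <#\<^bsub>C2\<^esub> ({p} \<times> carrier B) = {a \<otimes>\<^bsub>A\<^esub> p} \<times> carrier B"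
proof
  show "(a, b) <#\<^bsub>C2\<^esub> ({p} \<times> carrier B) \<subseteq> {a \<otimes>\<^bsub>A\<^esub> p} \<times> carrier B"
    using assms by (auto simp: l_coset_def mult_C2 closed)
  show "{a \<otimes>\<^bsub>A\<^esub> p} \<times> carrier B \<subseteq> (a, b) <#\<^bsub>C2\<^esub> ({p} \<times> carrier B)"
  proof
    fix x assume "x \<in> {a \<otimes>\<^bsub>A\<^esub> p} \<times> carrier B"
    then obtain q where x: "x = (a \<otimes>\<^bsub>A\<^esub> p, q)" "q \<in> carrier B" by auto
    then obtain v d where vd: "v \<in> carrier A" "d \<in> carrier B" "(a, b) \<otimes>\<^bsub>C2\<^esub> (v, d) = x"
      using left_division_C2[of a b "a \<otimes>\<^bsub>A\<^esub> p" q] assms by (auto simp: carrier_C2 closed)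
    then have "v = p"
      using A.l_cancel[of a v p] assms x by (simp add: mult_C2)
    then show "x \<in> (a, b) <#\<^bsub>C2\<^esub> ({p} \<times> carrier B)"
      using vd by (auto simp: l_coset_def)
  qed
qed

lemma r_coset_fibre:
  assumes "a \<in> carrier A" "b \<in> carrier B" "p \<in> carrier A"
  shows "({p} \<times> carrier B) #>\<^bsub>C2\<^esub> (a, b) = {p \<otimes>\<^bsub>A\<^esub> a} \<times> carrier B"
proof
  show "({p} \<times> carrier B) #>\<^bsub>C2\<^esub> (a, b) \<subseteq> {p \<otimes>\<^bsub>A\<^esub> a} \<times> carrier B"
    using assms by (auto simp: r_coset_def mult_C2 closed)
  show "{p \<otimes>\<^bsub>A\<^esub> a} \<times> carrier B \<subseteq> ({p} \<times> carrier B) #>\<^bsub>C2\<^esub> (a, b)"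
  proof
    fix x assume "x \<in> {p \<otimes>\<^bsub>A\<^esub> a} \<times> carrier B"
    then obtain q where x: "x = (p \<otimes>\<^bsub>A\<^esub> a, q)" "q \<in> carrier B" by auto
    then obtain u d where ud: "u \<in> carrier A" "d \<in> carrier B" "(u, d) \<otimes>\<^bsub>C2\<^esub> (a, b) = x"
      using right_division_C2[of a b "p \<otimes>\<^bsub>A\<^esub> a" q] assms by (auto simp: carrier_C2 closed)
    then have "u = p"
      using A.r_cancel[of a u p] assms x by (simp add: mult_C2)
    then show "x \<in> ({p} \<times> carrier B) #>\<^bsub>C2\<^esub> (a, b)"
      using ud by (auto simp: r_coset_def)
  qed
qed

lemma embed_right_image: "embed_right A ` carrier B = {\<one>\<^bsub>A\<^esub>} \<times> carrier B"
  by (auto simp: embed_right_def)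

text \<open>Both sides of each coset identity are fibres over products in \<open>A\<close>. The base
  points agree because one of the three factors in each product is \<open>\<one>\<close>.\<close>

lemma normal_submetagroup_C2:
  assumes "metagroup C2"
  shows "normal_submetagroup (embed_right A ` carrier B) C2"
proof -
  interpret C2: metagroup C2 by fact
  let ?H = "{\<one>\<^bsub>A\<^esub>} \<times> carrier B"
  have "submetagroup ?H C2"
  proof (rule C2.submetagroupI)
    \<comment> \<open>The first coordinate of a product is the product in \<open>A\<close>; if it
      and the first coordinate of \<open>x\<close> are both \<open>\<one>\<close>, then so is that
      of \<open>y\<close>.\<close>
    fix x y assume x: "x \<in> ?H" and y: "y \<in> carrier C2"
    show "y \<in> ?H" if "x \<otimes>\<^bsub>C2\<^esub> y \<in> ?H"
      using that x y by (auto simp: carrier_C2 mult_C2 A.l_one)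
    show "y \<in> ?H" if "y \<otimes>\<^bsub>C2\<^esub> x \<in> ?H"
      using that x y by (auto simp: carrier_C2 mult_C2 A.r_one)
  qed (auto simp: carrier_C2 one_C2 mult_C2 A.l_one closed)
  then show ?thesis
    unfolding embed_right_image normal_submetagroup_def almost_normal_submetagroup_def
    by (auto simp: carrier_C2 l_coset_fibre r_coset_fibre mult_C2 closed A.l_one A.r_one)
qed

end

theorem theorem3p4:
  fixes A :: "'a monoid" and B :: "'b monoid" and Z :: "'z monoid"
    and \<iota>A :: "'z \<Rightarrow> 'a" and \<iota>B :: "'z \<Rightarrow> 'b"
    and \<Xi> :: "(('a \<times> 'b) \<times> ('a \<times> 'b)) set"
    and \<phi> :: "'a \<Rightarrow> 'b \<Rightarrow> 'b"
    and \<eta> :: "'a \<Rightarrow> 'a \<Rightarrow> 'b \<Rightarrow> 'z"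
    and \<kappa> :: "'a \<Rightarrow> 'b \<Rightarrow> 'b \<Rightarrow> 'z"
    and \<xi> :: "('a \<times> 'b) set \<Rightarrow> ('a \<times> 'b) set \<Rightarrow> 'z"
    and C2 :: "('a \<times> 'b) monoid"
  assumes smashing: "smashing_data A B Z \<iota>A \<iota>B \<Xi> \<phi> \<eta> \<kappa> \<xi>"
    and eta_min_center: "\<And>\<gamma> u b. \<lbrakk>\<gamma> \<in> carrier Z; \<iota>A \<gamma> \<in> min_center A; u \<in> carrier A; b \<in> carrier B\<rbrakk>
      \<Longrightarrow> \<eta> (\<iota>A \<gamma>) u b = \<one>\<^bsub>Z\<^esub>"
    and C2: "C2 = smashed_product A B \<iota>B \<Xi> \<phi> \<xi>"
  shows "metagroup C2 \<and>
    (embed_left B \<in> carrier A \<rightarrow> carrier C2 \<and> inj_on (embed_left B) (carrier A) \<and>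
     embed_right A \<in> carrier B \<rightarrow> carrier C2 \<and> inj_on (embed_right A) (carrier B) \<and>
     almost_normal_submetagroup (embed_right A ` carrier B) C2) \<and>
    (min_center C2 \<subseteq> embed_right A ` min_center B \<and> min_center B \<subseteq> \<iota>B ` carrier Z \<longrightarrow>
     normal_submetagroup (embed_right A ` carrier B) C2)"
proof -
  interpret smashing_data A B Z \<iota>A \<iota>B \<Xi> \<phi> \<eta> \<kappa> \<xi> by (rule smashing)
  have meta: "metagroup C2"
    unfolding C2 by (rule metagroup_C2[OF eta_min_center])
  then have normal: "normal_submetagroup (embed_right A ` carrier B) C2"
    unfolding C2 by (rule normal_submetagroup_C2)
  then have "almost_normal_submetagroup (embed_right A ` carrier B) C2"
    by (simp add: normal_submetagroup_def)
  then show ?thesis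
    using meta normal unfolding C2
    by (auto simp: embed_left_def embed_right_def carrier_C2 closed inj_on_def)
qed

end
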